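(* Let $(a_n)_{n\ge 0}$, $(b_n)_{n\ge 0}$ be sequences of complex numbers with $b_0=1$ and $a_n\ne 0$ for all $n\ge 0$. Let $\mathscr{A}$ be the infinite lower triangular matrix with entries $\mathscr{A}_{n,k}=a_nb_{n-k}a_k^{-1}$ for $n\ge k\ge 0$ (and $0$ for $k>n$). Then for every integer $j$ (positive, zero or negative), the matrix power $\mathscr{A}^j$ belongs to $SDR_\infty$ (where $\mathscr{A}^0$ is the identity matrix).
   Context: All matrices are infinite lower triangular matrices $\mathscr{A}=(A_{n,k})_{n\ge k\ge 0}$ with complex entries; we set $A_{n,k}=0$ whenever $k>n$. For an integer $m\ge 3$, $\mathscr{A}$ is called an SDR-matrix of order $m$ (written $\mathscr{A}\in SDR_m$) if for all integers $n,k\ge 0$, all $2\le p\le m-1$ and all $0\le r\le p-1$, $$\prod_{i=0}^{r}A_{n+i,k+r-i}\prod_{i=0}^{p-r-1}A_{n+p-i,k+r+i+1}=\prod_{i=0}^{r}A_{n+p-i,k+p-r+i}\prod_{i=0}^{p-r-1}A_{n+i,k+p-r-i-1}.$$ $SDR_\infty$ denotes the set of matrices lying in $SDR_m$ for every $m\ge 3$. *)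

theory Defs
  imports Complex_Main
begin

type_synonym inf_matrix = "nat \<Rightarrow> nat \<Rightarrow> complex"

definition lower_triangular :: "inf_matrix \<Rightarrow> bool" where
  "lower_triangular A \<longleftrightarrow> (\<forall>n k. n < k \<longrightarrow> A n k = 0)"

text \<open>For a lower triangular left factor the terms with \<open>i > n\<close> vanish, so the
  finite sum below is the full row-by-column product.\<close>

definition ltm_mult :: "inf_matrix \<Rightarrow> inf_matrix \<Rightarrow> inf_matrix" where
  "ltm_mult A B = (\<lambda>n k. \<Sum>i\<le>n. A n i * B i k)"

definition ltm_one :: inf_matrix where
  "ltm_one = (\<lambda>n k. if n = k then 1 else 0)"

text \<open>The two-sided inverse in the monoid of lower triangular matrices. It exists, and is
  then unique, exactly when all diagonal entries are nonzero; for other matrices the value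
  is unspecified.\<close>

definition ltm_inverse :: "inf_matrix \<Rightarrow> inf_matrix" where
  "ltm_inverse A =
     (THE B. lower_triangular B \<and> ltm_mult A B = ltm_one \<and> ltm_mult B A = ltm_one)"

primrec ltm_power :: "inf_matrix \<Rightarrow> nat \<Rightarrow> inf_matrix" where
  "ltm_power A 0 = ltm_one"
| "ltm_power A (Suc n) = ltm_mult A (ltm_power A n)"

definition ltm_power_int :: "inf_matrix \<Rightarrow> int \<Rightarrow> inf_matrix" where
  "ltm_power_int A j =
     (if j \<ge> 0 then ltm_power A (nat j) else ltm_power (ltm_inverse A) (nat (- j)))"

text \<open>In the ranges of \<open>p\<close>, \<open>r\<close> and \<open>i\<close> considered below, with \<open>m \<ge> 3\<close>, none of the
  subtractions on natural numbers truncates.\<close>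

definition SDR :: "nat \<Rightarrow> inf_matrix set" where
  "SDR m = {A. lower_triangular A \<and>
     (\<forall>n k p r. 2 \<le> p \<and> p \<le> m - 1 \<and> r \<le> p - 1 \<longrightarrow>
        (\<Prod>i=0..r. A (n + i) (k + r - i)) *
        (\<Prod>i=0..p - r - 1. A (n + p - i) (k + r + i + 1))
        =
        (\<Prod>i=0..r. A (n + p - i) (k + p - r + i)) *
        (\<Prod>i=0..p - r - 1. A (n + i) (k + p - r - i - 1)))}"

definition SDR_inf :: "inf_matrix set" where
  "SDR_inf = (\<Inter>m\<in>{3..}. SDR m)"

end

theory Submission
  imports Defs "HOL-Computational_Algebra.Formal_Power_Series"
begin

text \<open>
  The SDR identity with parameters \<open>p\<close> and \<open>r\<close> concerns the square window with rows
  \<open>n, \<dots>, n + p\<close> and columns \<open>k, \<dots>, k + p\<close>. Put two diagonal blocks of sizes \<open>s = r + 1\<close> and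
  \<open>t = p - r\<close> into this window; the identity says that the product of the antidiagonal entries
  of the two blocks does not depend on which block comes first. A Toeplitz matrix satisfies it because
  its antidiagonal products do not change when a block moves along the diagonal. Scaling rows
  and columns preserves it because either arrangement meets every row and every column of the window
  exactly once.

  The given matrix is \<open>D T D\<^sup>-\<^sup>1\<close> with \<open>D\<close> diagonal and \<open>T\<close> the Toeplitz matrix of
  \<open>f = \<Sum> b\<^sub>n x\<^sup>n\<close>. Toeplitz matrices multiply like their power series, so its \<open>j\<close>-th power
  is \<open>D T\<^sub>j D\<^sup>-\<^sup>1\<close> with \<open>T\<^sub>j\<close> the Toeplitz matrix of \<open>f\<^sup>j\<close>.
\<close>

definition antidiagonal_prod ::
    "(nat \<Rightarrow> nat \<Rightarrow> 'a::comm_monoid_mult) \<Rightarrow> nat \<Rightarrow> nat \<Rightarrow> nat \<Rightarrow> 'a" where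
  "antidiagonal_prod A n k s = (\<Prod>i<s. A (n + i) (k + (s - Suc i)))"

lemma antidiagonal_prod_0 [simp]: "antidiagonal_prod A n k 0 = 1"
  by (simp add: antidiagonal_prod_def)

lemma antidiagonal_prod_Suc: "antidiagonal_prod A n k (Suc r) = (\<Prod>i=0..r. A (n + i) (k + r - i))"
  unfolding antidiagonal_prod_def by (intro prod.cong) auto

lemma antidiagonal_prod_Suc_rev:
  "antidiagonal_prod A n k (Suc r) = (\<Prod>i=0..r. A (n + r - i) (k + i))"
  unfolding antidiagonal_prod_Suc
  by (intro prod.reindex_bij_witness[of _ "\<lambda>i. r - i" "\<lambda>i. r - i"]) auto

lemma SDR_identity_iff:
  assumes "r < p"
  shows "(\<Prod>i=0..r. A (n + i) (k + r - i)) * (\<Prod>i=0..p - r - 1. A (n + p - i) (k + r + i + 1)) =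
      (\<Prod>i=0..r. A (n + p - i) (k + p - r + i)) * (\<Prod>i=0..p - r - 1. A (n + i) (k + p - r - i - 1))
    \<longleftrightarrow> antidiagonal_prod A n k (Suc r) * antidiagonal_prod A (n + Suc r) (k + Suc r) (p - r) =
      antidiagonal_prod A n k (p - r) * antidiagonal_prod A (n + (p - r)) (k + (p - r)) (Suc r)"
proof -
  obtain q where p: "p = Suc (r + q)"
    using assms less_imp_Suc_add by blast
  have size: "p - r = Suc q"
    by (simp add: p)
  have "(\<Prod>i=0..p - r - 1. A (n + p - i) (k + r + i + 1)) =
      antidiagonal_prod A (n + Suc r) (k + Suc r) (p - r)"
    unfolding size antidiagonal_prod_Suc_rev by (simp add: p ac_simps)
  moreover have "(\<Prod>i=0..r. A (n + p - i) (k + p - r + i)) =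
      antidiagonal_prod A (n + (p - r)) (k + (p - r)) (Suc r)"
    unfolding size antidiagonal_prod_Suc_rev by (simp add: p ac_simps)
  moreover have "(\<Prod>i=0..p - r - 1. A (n + i) (k + p - r - i - 1)) = antidiagonal_prod A n k (p - r)"
    unfolding size antidiagonal_prod_Suc by (simp add: p)
  ultimately show ?thesis
    by (simp add: antidiagonal_prod_Suc mult.commute)
qed

lemma mem_SDR_iff:
  "A \<in> SDR m \<longleftrightarrow> lower_triangular A \<and>
    (\<forall>n k s t. s + t \<le> m \<longrightarrow>
      antidiagonal_prod A n k s * antidiagonal_prod A (n + s) (k + s) t =
      antidiagonal_prod A n k t * antidiagonal_prod A (n + t) (k + t) s)"
  (is "_ \<longleftrightarrow> _ \<and> (\<forall>n k s t. _ \<longrightarrow> ?swap n k s t)")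
proof -
  have "A \<in> SDR m \<longleftrightarrow> lower_triangular A \<and>
      (\<forall>n k p r. 2 \<le> p \<and> p \<le> m - 1 \<and> r \<le> p - 1 \<longrightarrow> ?swap n k (Suc r) (p - r))"
    unfolding SDR_def mem_Collect_eq by (intro conj_cong iff_allI imp_cong refl SDR_identity_iff) auto
  also have "(\<forall>n k p r. 2 \<le> p \<and> p \<le> m - 1 \<and> r \<le> p - 1 \<longrightarrow> ?swap n k (Suc r) (p - r)) \<longleftrightarrow>
      (\<forall>n k s t. s + t \<le> m \<longrightarrow> ?swap n k s t)"
  proof (intro iffI allI impI)
    fix n k s t
    assume swap: "\<forall>n k p r. 2 \<le> p \<and> p \<le> m - 1 \<and> r \<le> p - 1 \<longrightarrow> ?swap n k (Suc r) (p - r)"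
      and "s + t \<le> m"
    consider (trivial) "s = 0 \<or> t = 0 \<or> s = t" | (proper) r where "s = Suc r" "0 < t" "3 \<le> s + t"
      by (cases s; cases t) force+
    then show "?swap n k s t"
    proof cases
      case (proper r)
      then have "2 \<le> r + t \<and> r + t \<le> m - 1 \<and> r \<le> r + t - 1"
        using \<open>s + t \<le> m\<close> by linarith
      from swap[rule_format, OF this] show ?thesis
        using \<open>s = Suc r\<close> by simp
    qed auto
  next
    fix n k p r
    assume swap: "\<forall>n k s t. s + t \<le> m \<longrightarrow> ?swap n k s t" and "2 \<le> p \<and> p \<le> m - 1 \<and> r \<le> p - 1"
    then show "?swap n k (Suc r) (p - r)"
      by (intro swap[rule_format]) linarith
  qed
  finally show ?thesis .
qed

definition diagonal_scale ::
    "(nat \<Rightarrow> 'a::times) \<Rightarrow> (nat \<Rightarrow> 'a) \<Rightarrow> (nat \<Rightarrow> nat \<Rightarrow> 'a) \<Rightarrow> nat \<Rightarrow> nat \<Rightarrow> 'a" where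
  "diagonal_scale u v A = (\<lambda>n k. u n * A n k * v k)"

lemma lower_triangular_diagonal_scale:
  "lower_triangular A \<Longrightarrow> lower_triangular (diagonal_scale u v A)"
  by (simp add: lower_triangular_def diagonal_scale_def)

lemma antidiagonal_prod_diagonal_scale:
  "antidiagonal_prod (diagonal_scale u v A) n k s =
    prod u {n..<n + s} * antidiagonal_prod A n k s * prod v {k..<k + s}"
proof -
  have "(\<Prod>i<s. v (k + (s - Suc i))) = (\<Prod>i<s. v (k + i))"
    by (rule prod.nat_diff_reindex)
  moreover have "(\<Prod>i<s. x (l + i)) = prod x {l..<l + s}" for x :: "nat \<Rightarrow> 'a" and l
    by (simp add: prod.atLeastLessThan_shift_0[of x l] atLeast0LessThan)
  ultimately show ?thesis
    by (simp add: antidiagonal_prod_def diagonal_scale_def prod.distrib)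
qed

lemma diagonal_scale_in_SDR:
  assumes "A \<in> SDR m"
  shows "diagonal_scale u v A \<in> SDR m"
  unfolding mem_SDR_iff
proof (intro conjI allI impI)
  let ?S = "diagonal_scale u v A"
  have scale: "antidiagonal_prod ?S n k s * antidiagonal_prod ?S (n + s) (k + s) t =
      prod u {n..<n + s + t} *
      (antidiagonal_prod A n k s * antidiagonal_prod A (n + s) (k + s) t) *
      prod v {k..<k + s + t}" for n k s t
  proof -
    have "prod x {l..<l + s + t} = prod x {l..<l + s} * prod x {l + s..<l + s + t}"
      for x :: "nat \<Rightarrow> complex" and l
      by (simp add: prod.atLeastLessThan_concat)
    then show ?thesis
      by (simp only: antidiagonal_prod_diagonal_scale mult_ac)
  qed
  fix n k s t :: nat
  assume "s + t \<le> m"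
  then show "antidiagonal_prod ?S n k s * antidiagonal_prod ?S (n + s) (k + s) t =
      antidiagonal_prod ?S n k t * antidiagonal_prod ?S (n + t) (k + t) s"
    using assms by (simp add: scale mem_SDR_iff add.assoc add.commute[of t s])
qed (use assms in \<open>simp add: mem_SDR_iff lower_triangular_diagonal_scale\<close>)

definition toeplitz :: "'a::zero fps \<Rightarrow> nat \<Rightarrow> nat \<Rightarrow> 'a" where
  "toeplitz f = (\<lambda>n k. if k \<le> n then fps_nth f (n - k) else 0)"

lemma lower_triangular_toeplitz: "lower_triangular (toeplitz f)"
  by (simp add: lower_triangular_def toeplitz_def)

lemma toeplitz_shift: "toeplitz f (n + d) (k + d) = toeplitz f n k"
  by (simp add: toeplitz_def)

lemma antidiagonal_prod_toeplitz_shift: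
  "antidiagonal_prod (toeplitz f) (n + d) (k + d) s = antidiagonal_prod (toeplitz f) n k s"
  unfolding antidiagonal_prod_def
  by (simp only: add.assoc add.commute[of d]) (simp only: add.assoc[symmetric] toeplitz_shift)

lemma toeplitz_in_SDR: "toeplitz f \<in> SDR m"
  by (simp add: mem_SDR_iff lower_triangular_toeplitz antidiagonal_prod_toeplitz_shift mult.commute)

lemma ltm_mult_assoc:
  assumes "lower_triangular B"
  shows "ltm_mult (ltm_mult A B) C = ltm_mult A (ltm_mult B C)"
proof (intro ext)
  fix n k
  have row: "(\<Sum>i\<le>l. B l i * C i k) = (\<Sum>i\<le>n. B l i * C i k)" if "l \<le> n" for l
    using assms that by (intro sum.mono_neutral_left) (auto simp: lower_triangular_def)
  have "ltm_mult (ltm_mult A B) C n k = (\<Sum>i\<le>n. \<Sum>l\<le>n. A n l * B l i * C i k)"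
    by (simp add: ltm_mult_def sum_distrib_right)
  also have "\<dots> = (\<Sum>l\<le>n. \<Sum>i\<le>n. A n l * B l i * C i k)"
    by (rule sum.swap)
  also have "\<dots> = (\<Sum>l\<le>n. A n l * (\<Sum>i\<le>l. B l i * C i k))"
    by (intro sum.cong) (simp_all add: row sum_distrib_left mult.assoc)
  finally show "ltm_mult (ltm_mult A B) C n k = ltm_mult A (ltm_mult B C) n k"
    by (simp add: ltm_mult_def)
qed

lemma ltm_mult_one_left: "ltm_mult ltm_one A = A"
  by (simp add: fun_eq_iff ltm_mult_def ltm_one_def if_distrib[of "\<lambda>x. x * _"] cong: if_cong)

lemma ltm_mult_one_right: "lower_triangular A \<Longrightarrow> ltm_mult A ltm_one = A"
  by (auto simp: fun_eq_iff ltm_mult_def ltm_one_def lower_triangular_def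
        if_distrib[of "\<lambda>x. _ * x"] cong: if_cong)

definition ltm_inverse_pair :: "inf_matrix \<Rightarrow> inf_matrix \<Rightarrow> bool" where
  "ltm_inverse_pair A B \<longleftrightarrow> lower_triangular A \<and> lower_triangular B \<and>
    ltm_mult A B = ltm_one \<and> ltm_mult B A = ltm_one"

lemma ltm_inverse_eqI:
  assumes "ltm_inverse_pair A B"
  shows "ltm_inverse A = B"
  unfolding ltm_inverse_def
proof (rule the_equality)
  fix C
  assume C: "lower_triangular C \<and> ltm_mult A C = ltm_one \<and> ltm_mult C A = ltm_one"
  have "C = ltm_mult C (ltm_mult A B)"
    using C assms by (simp add: ltm_inverse_pair_def ltm_mult_one_right)
  also have "\<dots> = ltm_mult (ltm_mult C A) B"
    using assms by (simp add: ltm_inverse_pair_def ltm_mult_assoc)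
  also have "\<dots> = B"
    using C by (simp add: ltm_mult_one_left)
  finally show "C = B" .
qed (use assms in \<open>simp add: ltm_inverse_pair_def\<close>)

lemma ltm_mult_diagonal_scale:
  assumes "\<And>i. v i * u' i = 1"
  shows "ltm_mult (diagonal_scale u v A) (diagonal_scale u' v' B) =
    diagonal_scale u v' (ltm_mult A B)"
proof (intro ext)
  fix n k
  have cancel: "u n * A n i * v i * (u' i * B i k * v' k) = u n * (A n i * B i k) * v' k" for i
  proof -
    have "u n * A n i * v i * (u' i * B i k * v' k) = u n * (A n i * B i k) * (v i * u' i) * v' k"
      by (simp only: mult_ac)
    then show ?thesis
      by (simp add: assms)
  qed
  show "ltm_mult (diagonal_scale u v A) (diagonal_scale u' v' B) n k =
      diagonal_scale u v' (ltm_mult A B) n k"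
    by (simp only: ltm_mult_def diagonal_scale_def cancel sum_distrib_left sum_distrib_right)
qed

lemma diagonal_scale_ltm_one:
  assumes "\<And>n. u n * v n = 1"
  shows "diagonal_scale u v ltm_one = ltm_one"
  by (auto simp: fun_eq_iff diagonal_scale_def ltm_one_def assms)

lemma ltm_power_diagonal_scale:
  assumes "\<And>n. u n * v n = 1"
  shows "ltm_power (diagonal_scale u v A) m = diagonal_scale u v (ltm_power A m)"
  by (induction m)
    (simp_all add: assms diagonal_scale_ltm_one ltm_mult_diagonal_scale mult.commute[of "v _"])

lemma ltm_inverse_pair_diagonal_scale:
  assumes "ltm_inverse_pair A B" and "\<And>n. u n * v n = 1"
  shows "ltm_inverse_pair (diagonal_scale u v A) (diagonal_scale u v B)"
  using assms
  by (simp add: ltm_inverse_pair_def lower_triangular_diagonal_scale diagonal_scale_ltm_one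
      ltm_mult_diagonal_scale mult.commute[of "v _"])

lemma ltm_power_int_diagonal_scale:
  assumes "ltm_inverse_pair A B" and "\<And>n. u n * v n = 1"
  shows "ltm_power_int (diagonal_scale u v A) j = diagonal_scale u v (ltm_power_int A j)"
proof -
  have "ltm_inverse (diagonal_scale u v A) = diagonal_scale u v (ltm_inverse A)"
    using assms by (simp add: ltm_inverse_eqI ltm_inverse_pair_diagonal_scale)
  then show ?thesis
    by (simp add: ltm_power_int_def ltm_power_diagonal_scale assms(2))
qed

lemma ltm_mult_toeplitz: "ltm_mult (toeplitz f) (toeplitz g) = toeplitz (f * g)"
proof (intro ext)
  fix n k
  let ?t = "\<lambda>i. toeplitz f n i * toeplitz g i k"
  show "ltm_mult (toeplitz f) (toeplitz g) n k = toeplitz (f * g) n k"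
  proof (cases "k \<le> n")
    case True
    have "(\<Sum>i\<le>n. ?t i) = (\<Sum>i=k..n. ?t i)"
      by (intro sum.mono_neutral_right) (auto simp: toeplitz_def)
    also have "\<dots> = (\<Sum>i=0..n - k. fps_nth f i * fps_nth g (n - k - i))"
      using True
      by (intro sum.reindex_bij_witness[of _ "\<lambda>i. n - i" "\<lambda>i. n - i"]) (auto simp: toeplitz_def)
    finally show ?thesis
      using True by (simp add: ltm_mult_def toeplitz_def fps_mult_nth)
  qed (auto simp: ltm_mult_def toeplitz_def)
qed

lemma toeplitz_1: "toeplitz 1 = ltm_one"
  by (auto simp: fun_eq_iff toeplitz_def ltm_one_def)

lemma ltm_power_toeplitz: "ltm_power (toeplitz f) m = toeplitz (f ^ m)"
  by (induction m) (simp_all add: toeplitz_1 ltm_mult_toeplitz)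

lemma ltm_inverse_pair_toeplitz:
  assumes "fps_nth f 0 \<noteq> 0"
  shows "ltm_inverse_pair (toeplitz f) (toeplitz (inverse f))"
  using assms
  by (simp add: ltm_inverse_pair_def lower_triangular_toeplitz ltm_mult_toeplitz toeplitz_1
      inverse_mult_eq_1 inverse_mult_eq_1')

lemma ltm_power_int_toeplitz:
  assumes "fps_nth f 0 \<noteq> 0"
  shows "ltm_power_int (toeplitz f) j = toeplitz (f powi j)"
  using ltm_inverse_eqI[OF ltm_inverse_pair_toeplitz[OF assms]]
  by (simp add: ltm_power_int_def power_int_def ltm_power_toeplitz)

theorem theorem2p2:
  fixes a b :: "nat \<Rightarrow> complex" and j :: int
  assumes "b 0 = 1" and "\<And>n. a n \<noteq> 0"
  shows "ltm_power_int (\<lambda>n k. if k \<le> n then a n * b (n - k) * inverse (a k) else 0) j \<in> SDR_inf"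
proof -
  let ?f = "Abs_fps b" and ?c = "\<lambda>k. inverse (a k)"
  have nonzero: "fps_nth ?f 0 \<noteq> 0"
    using assms(1) by simp
  have "(\<lambda>n k. if k \<le> n then a n * b (n - k) * inverse (a k) else 0) =
      diagonal_scale a ?c (toeplitz ?f)"
    by (simp add: diagonal_scale_def toeplitz_def fun_eq_iff)
  moreover have "ltm_power_int (diagonal_scale a ?c (toeplitz ?f)) j =
      diagonal_scale a ?c (ltm_power_int (toeplitz ?f) j)"
    using assms(2)
    by (intro ltm_power_int_diagonal_scale[OF ltm_inverse_pair_toeplitz[OF nonzero]]) simp
  moreover have "diagonal_scale a ?c (toeplitz (?f powi j)) \<in> SDR_inf"
    by (simp add: SDR_inf_def diagonal_scale_in_SDR toeplitz_in_SDR)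
  ultimately show ?thesis
    by (simp add: ltm_power_int_toeplitz[OF nonzero])
qed

end
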